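(* Let $n\ge 1$, let $\mathbf{e}=(1,\ldots,1)\in\mathbb{R}^n$ and let $\boldsymbol{\Delta}=\{\mathbf{x}\in\mathbb{R}^n_+ : \mathbf{e}^T\mathbf{x}\le 1\}$ be the canonical simplex. (1) If $f\in\mathbb{R}[\mathbf{x}]$ is a polynomial of total degree $t\in\mathbb{N}$, then with $\boldsymbol{\xi}_j:=\mathbf{e}/((n+1)\cdots(n+j))^{1/j}$ for $j=1,\ldots,t$, $$\int_{\boldsymbol{\Delta}} f\,d\mathbf{x}=\frac{1}{n!}\Big(\hat f_0+\sum_{j=1}^t \hat f_j(\boldsymbol{\xi}_j)\Big),$$ where $f=\sum_{j=0}^t f_j$, each $f_j$ is the homogeneous form of degree $j$ given by the sum of all monomials of degree $j$ of $f$ (with their coefficients), and $\hat f_j$ is the Bombieri polynomial of $f_j$. (2) Let $M\subset\mathbb{R}^n$ be a finite set and let $f:(0,+\infty)^n\to\mathbb{R}$, $$f(\mathbf{x}):=\sum_{\alpha\in M} f_\alpha\,\mathbf{x}^\alpha,\qquad f_\alpha\in\mathbb{R},\quad \alpha\in\mathbb{R}^n,\ \alpha_i>-1,\ i=1,\ldots,n,$$ be positively homogeneous of degree $t\in\mathbb{R}$ (i.e. $\sum_i\alpha_i=t$ for all $\alpha\in M$). Then $$\int_{\boldsymbol{\Delta}} f\,d\mathbf{x}=\frac{1}{n!}\,\hat f(\boldsymbol{\xi}_t),$$ where $\boldsymbol{\xi}_t:=\frac{1}{\theta}\,\mathbf{e}\in\boldsymbol{\Delta}$ with $\theta>0$,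 $\theta^t=\Gamma(1+n+t)/\Gamma(1+n)$, and $$\hat f(\mathbf{x}):=\sum_{\alpha\in M}\Gamma(1+\alpha_1)\cdots\Gamma(1+\alpha_n)\,f_\alpha\,\mathbf{x}^\alpha .$$
   Context: $\mathbb{R}[\mathbf{x}]$ is the ring of real polynomials in $\mathbf{x}=(x_1,\ldots,x_n)$; $\mathbb{R}^n_+=\{\mathbf{x}\in\mathbb{R}^n:\mathbf{x}\ge 0\}$; $\mathbf{x}^\alpha=x_1^{\alpha_1}\cdots x_n^{\alpha_n}$; $\mathbb{N}$ includes $0$. Integrals are with respect to Lebesgue measure. For a polynomial $f(\mathbf{x})=\sum_{\alpha\in\mathbb{N}^n} f_\alpha\mathbf{x}^\alpha$, its Bombieri polynomial is $\hat f(\mathbf{x})=\sum_{\alpha\in\mathbb{N}^n}\alpha_1!\cdots\alpha_n!\,f_\alpha\,\mathbf{x}^\alpha$ (so for the constant form $f_0$, $\hat f_0=f_0$). $\Gamma$ is the Euler Gamma function.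
   Formalization: In (2), ξ_t ∈ Δ is claimed only for t ≥ -1 (for t = 0, for a suitable θ): it is false for every t < -1, e.g. n = 2, α = (-0.95,-0.95) gives θ ≈ 1.48 < 2. Existence of θ is claimed for nonempty M; the integral formula holds for all t. *)

theory Defs
  imports "HOL-Analysis.Analysis" "HOL-Library.Poly_Mapping"
begin

text \<open>
  The dimension \<open>n \<ge> 1\<close> is \<open>CARD('n)\<close> for a finite index type \<open>'n\<close>. The ring
  \<open>\<real>[x\<^sub>1, \<dots>, x\<^sub>n]\<close> is the type \<open>('n \<Rightarrow>\<^sub>0 nat) \<Rightarrow>\<^sub>0 real\<close> of finitely supported maps from
  exponents to coefficients.
\<close>

definition canonical_simplex :: "(real ^ 'n) set" where
  "canonical_simplex = {x. (\<forall>i. 0 \<le> x $ i) \<and> vec 1 \<bullet> x \<le> 1}"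


subsection \<open>Polynomials\<close>

definition monom_degree :: "('n::finite \<Rightarrow>\<^sub>0 nat) \<Rightarrow> nat" where
  "monom_degree \<alpha> = (\<Sum>i\<in>UNIV. Poly_Mapping.lookup \<alpha> i)"

text \<open>The zero polynomial gets total degree \<open>0\<close>.\<close>

definition total_degree :: "(('n::finite \<Rightarrow>\<^sub>0 nat) \<Rightarrow>\<^sub>0 real) \<Rightarrow> nat" where
  "total_degree f = Max (insert 0 (monom_degree ` Poly_Mapping.keys f))"

definition poly_eval :: "(('n::finite \<Rightarrow>\<^sub>0 nat) \<Rightarrow>\<^sub>0 real) \<Rightarrow> real ^ 'n \<Rightarrow> real" where
  "poly_eval f x = (\<Sum>\<alpha>\<in>Poly_Mapping.keys f. Poly_Mapping.lookup f \<alpha> * (\<Prod>i\<in>UNIV. (x $ i) ^ Poly_Mapping.lookup \<alpha> i))"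

definition hom_part :: "nat \<Rightarrow> (('n::finite \<Rightarrow>\<^sub>0 nat) \<Rightarrow>\<^sub>0 real) \<Rightarrow> (('n \<Rightarrow>\<^sub>0 nat) \<Rightarrow>\<^sub>0 real)" where
  "hom_part j f =
     (\<Sum>\<alpha> | \<alpha> \<in> Poly_Mapping.keys f \<and> monom_degree \<alpha> = j. Poly_Mapping.single \<alpha> (Poly_Mapping.lookup f \<alpha>))"

definition bombieri :: "(('n::finite \<Rightarrow>\<^sub>0 nat) \<Rightarrow>\<^sub>0 real) \<Rightarrow> (('n \<Rightarrow>\<^sub>0 nat) \<Rightarrow>\<^sub>0 real)" where
  "bombieri f =
     (\<Sum>\<alpha>\<in>Poly_Mapping.keys f. Poly_Mapping.single \<alpha> ((\<Prod>i\<in>UNIV. fact (Poly_Mapping.lookup \<alpha> i)) * Poly_Mapping.lookup f \<alpha>))"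

definition xi_node :: "nat \<Rightarrow> real ^ 'n" where
  "xi_node j = (1 / (\<Prod>k = 1..j. real (CARD('n) + k)) powr (1 / real j)) *\<^sub>R vec 1"

lemma sum_hom_part: "f = (\<Sum>j\<le>total_degree f. hom_part j f)"
proof -
  have "(\<Sum>j\<le>total_degree f. hom_part j f) = (\<Sum>\<alpha>\<in>Poly_Mapping.keys f. Poly_Mapping.single \<alpha> (Poly_Mapping.lookup f \<alpha>))"
    unfolding hom_part_def
    by (rule sum.group) (auto simp: total_degree_def intro!: Max_ge)
  also have "\<dots> = f"
    by (intro poly_mapping_eqI)
       (auto simp: lookup_sum lookup_single when_def in_keys_iff)
  finally show ?thesis ..
qed


subsection \<open>Generalized polynomials with real exponents\<close>

text \<open>
  These are only meaningful on the open positive orthant: at \<open>0\<close> the function \<open>powr\<close>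
  has the conventional value \<open>0\<close>.
\<close>

definition gen_eval :: "(real ^ 'n) set \<Rightarrow> (real ^ 'n \<Rightarrow> real) \<Rightarrow> real ^ 'n \<Rightarrow> real" where
  "gen_eval M c x = (\<Sum>\<alpha>\<in>M. c \<alpha> * (\<Prod>i\<in>UNIV. (x $ i) powr (\<alpha> $ i)))"

definition gen_bombieri :: "(real ^ 'n \<Rightarrow> real) \<Rightarrow> real ^ 'n \<Rightarrow> real" where
  "gen_bombieri c \<alpha> = (\<Prod>i\<in>UNIV. Gamma (1 + \<alpha> $ i)) * c \<alpha>"

end

(* Slicing the scaled simplex {x >= 0, sum x <= s} at one coordinate and evaluating the remaining
   one-dimensional Beta integral yields, by induction on the dimension, Dirichlet's formula
   prod_i Gamma (1 + a_i) / Gamma (1 + n + |a|) for the integral of x^a. The numerator is the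
   Bombieri coefficient, and the denominator depends on |a| only, so on each homogeneous part it
   is absorbed into the evaluation point on the diagonal. For t >= -1 that point lies in the
   simplex, because log-convexity of Gamma gives theta >= n. *)

theory Submission
  imports Defs
begin

section \<open>Dirichlet's integral as an extended nonnegative integral\<close>

text \<open>The substitution y = s * u reduces this to Euler's Beta integral: the integrand
  contributes \<open>s powr (p + q)\<close> and the change of variable one more factor
  \<open>s\<close>. The extended nonnegative integral spares integrability conditions, although the
  integrand may be unbounded at both ends.\<close>

lemma nn_integral_Beta_Icc:
  fixes p q s :: real
  assumes "p > -1" "q > -1" "s > 0"
  shows "(\<integral>\<^sup>+y. ennreal (indicator {0..s} y * (y powr p * (s - y) powr q)) \<partial>lborel) =
         ennreal (s powr (p + q + 1) * Beta (p + 1) (q + 1))"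
proof -
  have Beta_int: "(\<integral>\<^sup>+y. ennreal (indicator {0..1} y * (y powr p * (1 - y) powr q)) \<partial>lborel) =
        ennreal (Beta (p + 1) (q + 1))"
    using nn_integral_has_integral_lebesgue[OF _ has_integral_Beta_real[of "p + 1" "q + 1"]] assms
    by simp
  have "(\<integral>\<^sup>+y. ennreal (indicator {0..s} y * (y powr p * (s - y) powr q)) \<partial>lborel) =
        ennreal s * (\<integral>\<^sup>+y. ennreal (indicator {0..s} (s * y) * ((s * y) powr p * (s - s * y) powr q)) \<partial>lborel)"
    using nn_integral_real_affine[of "\<lambda>y. ennreal (indicator {0..s} y * (y powr p * (s - y) powr q))" s 0] assms
    by simp
  also have "(\<lambda>y. ennreal (indicator {0..s} (s * y) * ((s * y) powr p * (s - s * y) powr q))) =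
        (\<lambda>y. ennreal (s powr (p + q)) * ennreal (indicator {0..1} y * (y powr p * (1 - y) powr q)))"
  proof
    fix y :: real
    have eq: "s - s * y = s * (1 - y)" by (simp add: algebra_simps)
    show "ennreal (indicator {0..s} (s * y) * ((s * y) powr p * (s - s * y) powr q)) =
        ennreal (s powr (p + q)) * ennreal (indicator {0..1} y * (y powr p * (1 - y) powr q))"
      unfolding eq using assms(3)
      by (auto simp: indicator_def powr_mult powr_add zero_le_mult_iff mult_le_cancel_left1
               simp flip: ennreal_mult)
  qed
  also have "ennreal s * (\<integral>\<^sup>+y. ennreal (s powr (p + q)) *
               ennreal (indicator {0..1} y * (y powr p * (1 - y) powr q)) \<partial>lborel) =
             ennreal s * (ennreal (s powr (p + q)) * ennreal (Beta (p + 1) (q + 1)))"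
    by (simp add: nn_integral_cmult Beta_int)
  also have "\<dots> = ennreal (s powr (p + q + 1) * Beta (p + 1) (q + 1))"
    using assms by (simp add: powr_add ac_simps flip: ennreal_mult' ennreal_mult'')
  finally show ?thesis .
qed

text \<open>The scale \<open>s\<close> stays general because fixing one coordinate at y leaves a
  simplex of scale s - y. The \<open>+ 1\<close> lies under the sum, so the exponent of
  \<open>s\<close> is the degree of the monomial plus the dimension.\<close>

lemma nn_integral_Dirichlet_PiM:
  fixes a :: "'b \<Rightarrow> real"
  assumes "finite A" "\<And>i. i \<in> A \<Longrightarrow> a i > -1" "s > 0"
  shows "(\<integral>\<^sup>+x. (if (\<forall>i\<in>A. 0 \<le> x i) \<and> sum x A \<le> s then ennreal (\<Prod>i\<in>A. x i powr a i) else 0)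
            \<partial>Pi\<^sub>M A (\<lambda>_. lborel)) =
         ennreal (s powr (\<Sum>i\<in>A. a i + 1) *
           ((\<Prod>i\<in>A. Gamma (1 + a i)) / Gamma (1 + (\<Sum>i\<in>A. a i + 1))))"
  using assms
proof (induction arbitrary: s rule: finite_induct)
  case empty
  then show ?case by (simp add: PiM_empty nn_integral_count_space_finite)
next
  case (insert b A s)
  interpret product_sigma_finite "\<lambda>_. lborel :: real measure" by standard
  let ?F = "\<lambda>A s x. if (\<forall>i\<in>A. 0 \<le> x i) \<and> sum x A \<le> s then ennreal (\<Prod>i\<in>A. x i powr a i) else 0"
  have meas: "?F A s \<in> borel_measurable (Pi\<^sub>M A (\<lambda>_. lborel))" if "finite A" for A :: "'b set" and s
    using that by measurable
  \<comment> \<open>The induction hypothesis evaluates the slice at y as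
    \<open>(s - y) powr B * C\<close>. Since \<open>B \<ge> 0\<close>, the Beta integral applies
    with \<open>B\<close> as second exponent.\<close>
  define B where "B = (\<Sum>i\<in>A. a i + 1)"
  define C where "C = (\<Prod>i\<in>A. Gamma (1 + a i)) / Gamma (1 + B)"
  have B: "B \<ge> 0" unfolding B_def using insert.prems(1) by (intro sum_nonneg) force
  have C: "C \<ge> 0" unfolding C_def using insert.prems(1) B
    by (intro divide_nonneg_nonneg prod_nonneg less_imp_le[OF Gamma_real_pos]) (force, linarith)
  have Gamma_B: "Gamma (B + 1) \<noteq> 0" using Gamma_real_pos[of "B + 1"] B by linarith
  have b: "a b > -1" using insert.prems by simp
  have "(\<integral>\<^sup>+x. ?F (insert b A) s x \<partial>Pi\<^sub>M (insert b A) (\<lambda>_. lborel)) =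
        (\<integral>\<^sup>+y. \<integral>\<^sup>+x. ?F (insert b A) s (x(b := y)) \<partial>Pi\<^sub>M A (\<lambda>_. lborel) \<partial>lborel)"
    using insert.hyps meas[of "insert b A" s] by (intro product_nn_integral_insert_rev) auto
  also have "\<dots> = (\<integral>\<^sup>+y. \<integral>\<^sup>+x. ennreal (indicator {0..s} y * y powr a b) * ?F A (s - y) x
                      \<partial>Pi\<^sub>M A (\<lambda>_. lborel) \<partial>lborel)"
  proof (intro nn_integral_cong)
    fix y :: real and x :: "'b \<Rightarrow> real"
    have upd: "(\<forall>i\<in>A. 0 \<le> (x(b := y)) i) \<longleftrightarrow> (\<forall>i\<in>A. 0 \<le> x i)" "sum (x(b := y)) A = sum x A"
      "(\<Prod>i\<in>A. (x(b := y)) i powr a i) = (\<Prod>i\<in>A. x i powr a i)"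
      using insert.hyps by (auto intro!: sum.cong prod.cong)
    \<comment> \<open>The bound y \<le> s on the right comes from the nonnegative sum of the
      remaining coordinates.\<close>
    have "(\<forall>i\<in>insert b A. 0 \<le> (x(b := y)) i) \<and> sum (x(b := y)) (insert b A) \<le> s \<longleftrightarrow>
          y \<in> {0..s} \<and> (\<forall>i\<in>A. 0 \<le> x i) \<and> sum x A \<le> s - y"
      using insert.hyps sum_nonneg[of A x] upd by auto
    moreover have "(\<Prod>i\<in>insert b A. (x(b := y)) i powr a i) = y powr a b * (\<Prod>i\<in>A. x i powr a i)"
      using insert.hyps upd by simp
    ultimately show "?F (insert b A) s (x(b := y)) =
        ennreal (indicator {0..s} y * y powr a b) * ?F A (s - y) x"
      by (auto simp: indicator_def ennreal_mult')
  qed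
  also have "\<dots> = (\<integral>\<^sup>+y. ennreal (indicator {0..s} y * y powr a b) *
                      (\<integral>\<^sup>+x. ?F A (s - y) x \<partial>Pi\<^sub>M A (\<lambda>_. lborel)) \<partial>lborel)"
    using insert.hyps meas[of A] by (intro nn_integral_cong nn_integral_cmult) auto
  also have "\<dots> = (\<integral>\<^sup>+y. ennreal C * ennreal (indicator {0..s} y * (y powr a b * (s - y) powr B)) \<partial>lborel)"
  \<comment> \<open>The endpoint y = s is discarded as a null set: the induction hypothesis demands
    a positive scale, and for empty \<open>A\<close> the two sides really differ there, because
    \<open>0 powr 0\<close> is 0.\<close>
  proof (rule nn_integral_cong_AE, rule AE_mp[OF AE_lborel_singleton[of s]], rule AE_I2, rule impI)
    fix y :: real assume "y \<noteq> s"
    then have "y \<notin> {0..s} \<or> 0 < s - y" by auto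
    then show "ennreal (indicator {0..s} y * y powr a b) * (\<integral>\<^sup>+x. ?F A (s - y) x \<partial>Pi\<^sub>M A (\<lambda>_. lborel)) =
        ennreal C * ennreal (indicator {0..s} y * (y powr a b * (s - y) powr B))"
    proof
      assume "0 < s - y"
      then have "(\<integral>\<^sup>+x. ?F A (s - y) x \<partial>Pi\<^sub>M A (\<lambda>_. lborel)) = ennreal ((s - y) powr B * C)"
        using insert.IH[of "s - y"] insert.prems unfolding B_def C_def by simp
      then show ?thesis using C by (simp add: ac_simps flip: ennreal_mult' ennreal_mult'')
    qed simp
  qed
  also have "\<dots> = ennreal C * ennreal (s powr (a b + B + 1) * Beta (a b + 1) (B + 1))"
    using nn_integral_Beta_Icc[of "a b" B s] b B insert.prems by (simp add: nn_integral_cmult)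
  also have "\<dots> = ennreal (s powr (a b + B + 1) * (C * Beta (a b + 1) (B + 1)))"
    using C by (simp add: ac_simps flip: ennreal_mult')
  \<comment> \<open>\<open>Gamma (B + 1)\<close> from the numerator of the Beta value cancels the
    denominator of \<open>C\<close>, so the quotient keeps its shape with one more
    coordinate.\<close>
  also have "C * Beta (a b + 1) (B + 1) =
      (\<Prod>i\<in>insert b A. Gamma (1 + a i)) / Gamma (1 + (a b + 1 + B))"
    using insert.hyps Gamma_B by (simp add: C_def Beta_def field_simps)
  finally show ?case using insert.hyps by (simp add: B_def ac_simps)
qed

text \<open>Lebesgue measure on a Euclidean space is the image of the product measure indexed by
  \<open>Basis\<close>, which transfers the product formula at scale 1.\<close>

lemma nn_integral_Dirichlet_euclidean:
  fixes a :: "'a::euclidean_space"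
  assumes "\<And>b. b \<in> Basis \<Longrightarrow> a \<bullet> b > -1"
  shows "(\<integral>\<^sup>+x. (if (\<forall>b\<in>Basis. 0 \<le> x \<bullet> b) \<and> (\<Sum>b\<in>Basis. x \<bullet> b) \<le> 1
                 then ennreal (\<Prod>b\<in>Basis. (x \<bullet> b) powr (a \<bullet> b)) else 0) \<partial>lborel) =
         ennreal ((\<Prod>b\<in>Basis. Gamma (1 + a \<bullet> b)) / Gamma (1 + (\<Sum>b\<in>Basis. a \<bullet> b + 1)))"
proof -
  have "(\<integral>\<^sup>+x. (if (\<forall>b\<in>Basis. 0 \<le> x \<bullet> b) \<and> (\<Sum>b\<in>Basis. x \<bullet> b) \<le> 1
                 then ennreal (\<Prod>b\<in>Basis. (x \<bullet> b) powr (a \<bullet> b)) else 0) \<partial>(lborel :: 'a measure)) =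
        (\<integral>\<^sup>+x. (if (\<forall>b\<in>Basis. 0 \<le> x b) \<and> sum x Basis \<le> 1
                 then ennreal (\<Prod>b\<in>Basis. x b powr (a \<bullet> b)) else 0) \<partial>Pi\<^sub>M Basis (\<lambda>_. lborel))"
    by (subst lborel_eq, subst nn_integral_distr) (auto intro!: nn_integral_cong)
  then show ?thesis
    using nn_integral_Dirichlet_PiM[of Basis "\<lambda>b. a \<bullet> b" 1] assms by simp
qed

section \<open>Growth of Gamma from log-convexity\<close>

text \<open>By the functional equation the chord of ln Gamma over [x, x + 1] has slope ln x. A
  convex function lies above the extended chord to the right of the interval and below the chord
  inside it; these are the two cases. With x the dimension, they bound \<theta> from below.\<close>

lemma Gamma_plus_real_bounds:
  fixes x t :: real
  assumes "x > 0"
  shows "t \<ge> 0 \<Longrightarrow> x powr t * Gamma (1 + x) \<le> Gamma (1 + x + t)"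
    and "t \<le> 0 \<Longrightarrow> t \<ge> -1 \<Longrightarrow> Gamma (1 + x + t) \<le> x powr t * Gamma (1 + x)"
proof -
  let ?g = "\<lambda>x::real. ln (Gamma x)"
  have convex: "convex_on {0<..} ?g" using log_convex_Gamma_real by (simp add: o_def)
  have pos: "Gamma x > 0" "Gamma (1 + x) > 0" using assms by (auto intro: Gamma_real_pos)
  then have nz: "Gamma x \<noteq> 0" "Gamma (1 + x) \<noteq> 0" by linarith+
  have "Gamma (1 + x) = x * Gamma x"
    using Gamma_plus1[of x] assms nonpos_Ints_nonpos[of x] by (auto simp: add.commute)
  then have step: "?g (1 + x) = ln x + ?g x" using assms nz by (simp add: ln_mult)
  {
    assume t: "t \<ge> 0"
    have pos': "Gamma (1 + x + t) > 0" using assms t by (intro Gamma_real_pos) auto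
    \<comment> \<open>The weight that makes \<open>1 + x\<close> a convex combination of
      \<open>x\<close> and \<open>1 + x + t\<close>.\<close>
    define u where "u = 1 / (1 + t)"
    have u: "0 \<le> u" "u \<le> 1" "u * (1 + t) = 1" using t by (auto simp: u_def)
    have "?g ((1 - u) *\<^sub>R x + u *\<^sub>R (1 + x + t)) \<le>
          (1 - u) * ?g x + u * ?g (1 + x + t)"
      using assms t u by (intro convex_onD[OF convex]) auto
    also have "(1 - u) *\<^sub>R x + u *\<^sub>R (1 + x + t) = 1 + x"
      using u(3) by (simp add: algebra_simps)
    finally have "(1 + t) * ?g (1 + x) \<le> (1 + t) * ((1 - u) * ?g x + u * ?g (1 + x + t))"
      using t by (intro mult_left_mono) auto
    also have "\<dots> = (1 + t - u * (1 + t)) * ?g x + (u * (1 + t)) * ?g (1 + x + t)"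
      by (simp add: algebra_simps)
    finally have "t * ln x + ?g (1 + x) \<le> ?g (1 + x + t)"
      unfolding u(3) using step by (simp add: algebra_simps)
    then have "ln (x powr t * Gamma (1 + x)) \<le> ?g (1 + x + t)"
      using assms nz by (simp add: ln_mult ln_powr)
    then show "x powr t * Gamma (1 + x) \<le> Gamma (1 + x + t)"
      using assms pos pos' by (subst (asm) ln_le_cancel_iff) auto
  }
  {
    assume t: "t \<le> 0" "t \<ge> -1"
    have pos': "Gamma (1 + x + t) > 0" using assms t by (intro Gamma_real_pos) auto
    \<comment> \<open>Now \<open>1 + x + t\<close> is the intermediate point, with weight
      \<open>1 + t\<close> on \<open>1 + x\<close>; \<open>t \<ge> -1\<close> makes this weight
      nonnegative.\<close>
    have "?g ((1 - (1 + t)) *\<^sub>R x + (1 + t) *\<^sub>R (1 + x)) \<le> (1 - (1 + t)) * ?g x + (1 + t) * ?g (1 + x)"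
      using assms t by (intro convex_onD[OF convex]) auto
    also have "(1 - (1 + t)) *\<^sub>R x + (1 + t) *\<^sub>R (1 + x) = 1 + x + t"
      by (simp add: algebra_simps)
    finally have "?g (1 + x + t) \<le> t * ln x + ?g (1 + x)"
      using step by (simp add: algebra_simps)
    then have "?g (1 + x + t) \<le> ln (x powr t * Gamma (1 + x))"
      using assms nz by (simp add: ln_mult ln_powr)
    then show "Gamma (1 + x + t) \<le> x powr t * Gamma (1 + x)"
      using assms pos pos' by (subst (asm) ln_le_cancel_iff) auto
  }
qed

section \<open>Real exponents on the canonical simplex\<close>

text \<open>The basis vectors are the \<open>axis i 1\<close>, so Dirichlet's formula can be read in
  coordinates. The integrand being nonnegative, a finite extended integral gives both integrability
  and the value.\<close>

lemma integral_canonical_simplex_monomial: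
  fixes a :: "real ^ 'n"
  assumes "\<And>i. a $ i > -1"
  shows "set_integrable lebesgue canonical_simplex (\<lambda>x. \<Prod>i\<in>UNIV. (x $ i) powr (a $ i))"
    and "(LINT x:canonical_simplex|lebesgue. \<Prod>i\<in>UNIV. (x $ i) powr (a $ i)) =
         (\<Prod>i\<in>UNIV. Gamma (1 + a $ i)) / Gamma (1 + real CARD('n) + (\<Sum>i\<in>UNIV. a $ i))"
proof -
  define m where "m x = (\<Prod>i\<in>UNIV. (x $ i) powr (a $ i))" for x :: "real ^ 'n"
  define I where "I = (\<Prod>i\<in>UNIV. Gamma (1 + a $ i)) / Gamma (1 + real CARD('n) + (\<Sum>i\<in>UNIV. a $ i))"
  have Basis: "(Basis :: (real ^ 'n) set) = range (\<lambda>i. axis i 1)"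
    by (auto simp: Basis_vec_def)
  have inj: "inj (\<lambda>i::'n. axis i (1::real))"
    by (auto simp: inj_on_def axis_eq_axis)
  have sum_Basis: "(\<Sum>b\<in>(Basis :: (real ^ 'n) set). h b) = (\<Sum>i\<in>UNIV. h (axis i 1))" for h :: "_ \<Rightarrow> real"
    unfolding Basis using inj by (subst sum.reindex) auto
  have prod_Basis: "(\<Prod>b\<in>(Basis :: (real ^ 'n) set). h b) = (\<Prod>i\<in>UNIV. h (axis i 1))" for h :: "_ \<Rightarrow> real"
    unfolding Basis using inj by (subst prod.reindex) auto
  have vec: "1 \<bullet> x = (\<Sum>i\<in>UNIV. x $ i)" for x :: "real ^ 'n"
    by (simp add: inner_vec_def)
  have nonneg: "I \<ge> 0"
  proof -
    have "(\<Sum>i\<in>UNIV. a $ i + 1) \<ge> 0" using assms by (intro sum_nonneg) (smt (verit))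
    then have "Gamma (1 + real CARD('n) + (\<Sum>i\<in>UNIV. a $ i)) > 0"
      by (intro Gamma_real_pos) (simp add: sum.distrib)
    moreover have "Gamma (1 + a $ i) > 0" for i using assms[of i] by (intro Gamma_real_pos) auto
    ultimately show ?thesis unfolding I_def
      by (intro divide_nonneg_nonneg prod_nonneg less_imp_le) auto
  qed
  have "closed (canonical_simplex :: (real ^ 'n) set)"
    unfolding canonical_simplex_def by (intro closed_Collect_conj closed_Collect_all closed_Collect_le continuous_intros)
  then have [measurable]: "(canonical_simplex :: (real ^ 'n) set) \<in> sets borel" by simp
  have [measurable]: "(\<lambda>x. x $ i) \<in> borel_measurable borel" for i :: 'n
    by (intro borel_measurable_continuous_onI continuous_intros)
  have [measurable]: "m \<in> borel_measurable borel"
    unfolding m_def by measurable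
  have "(\<integral>\<^sup>+x. ennreal (indicator canonical_simplex x *\<^sub>R m x) \<partial>lborel) = ennreal I"
  proof -
    have "(\<integral>\<^sup>+x. ennreal (indicator canonical_simplex x *\<^sub>R m x) \<partial>lborel) =
        (\<integral>\<^sup>+x. (if (\<forall>b\<in>Basis. 0 \<le> x \<bullet> b) \<and> (\<Sum>b\<in>Basis. x \<bullet> b) \<le> 1
                 then ennreal (\<Prod>b\<in>Basis. (x \<bullet> b) powr (a \<bullet> b)) else 0) \<partial>lborel)"
      unfolding sum_Basis prod_Basis
      by (intro nn_integral_cong)
         (auto simp: canonical_simplex_def vec Basis m_def indicator_def simp flip: cart_eq_inner_axis)
    also have "\<dots> = ennreal ((\<Prod>b\<in>Basis. Gamma (1 + a \<bullet> b)) / Gamma (1 + (\<Sum>b\<in>Basis. a \<bullet> b + 1)))"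
      using assms by (intro nn_integral_Dirichlet_euclidean) (auto simp: Basis simp flip: cart_eq_inner_axis)
    also have "\<dots> = ennreal I"
      unfolding sum_Basis prod_Basis by (simp add: I_def sum.distrib ac_simps flip: cart_eq_inner_axis)
    finally show ?thesis .
  qed
  then have "has_bochner_integral lborel (\<lambda>x. indicator canonical_simplex x *\<^sub>R m x) I"
    using nonneg by (intro has_bochner_integral_nn_integral) (auto simp: m_def intro!: AE_I2 prod_nonneg mult_nonneg_nonneg)
  then have "integrable lborel (\<lambda>x. indicator canonical_simplex x *\<^sub>R m x)"
      "(\<integral>x. indicator canonical_simplex x *\<^sub>R m x \<partial>lborel) = I"
    by (auto simp: has_bochner_integral_iff)
  \<comment> \<open>\<open>lebesgue\<close> is the completion of \<open>lborel\<close> and the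
    integrand is Borel, so integrability and value carry over.\<close>
  then show "set_integrable lebesgue canonical_simplex (\<lambda>x. \<Prod>i\<in>UNIV. (x $ i) powr (a $ i))"
    "(LINT x:canonical_simplex|lebesgue. \<Prod>i\<in>UNIV. (x $ i) powr (a $ i)) =
         (\<Prod>i\<in>UNIV. Gamma (1 + a $ i)) / Gamma (1 + real CARD('n) + (\<Sum>i\<in>UNIV. a $ i))"
    unfolding set_integrable_def set_lebesgue_integral_def m_def[symmetric] I_def[symmetric]
    by (auto simp: integrable_completion integral_completion)
qed

text \<open>The coordinate hyperplanes are null sets, so the integral sees only the open positive
  orthant, and conventional boundary values such as \<open>0 powr 0 = 0\<close> do no harm.\<close>

lemma canonical_simplex_integral_spike:
  fixes f g :: "real ^ 'n \<Rightarrow> real"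
  assumes "set_integrable lebesgue canonical_simplex f"
    and "\<And>x. (\<And>i. x $ i > 0) \<Longrightarrow> g x = f x"
  shows "set_integrable lebesgue canonical_simplex g"
    and "(LINT x:canonical_simplex|lebesgue. g x) = (LINT x:canonical_simplex|lebesgue. f x)"
proof -
  let ?N = "\<Union>i. {x :: real ^ 'n. x $ i = 0}"
  have N: "negligible ?N"
    by (intro negligible_Union_nat negligible_Union) (auto simp: negligible_standard_hyperplane_cart)
  have eq: "g x = f x" if "x \<in> canonical_simplex - ?N" for x
    using that by (intro assms(2)) (auto simp: canonical_simplex_def less_le)
  show "set_integrable lebesgue canonical_simplex g"
    using absolutely_integrable_spike[OF assms(1) N eq] .
  \<comment> \<open>The values are compared as gauge integrals, which agree with the Lebesgue ones
    because both functions are absolutely integrable.\<close>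
  with assms(1) integral_spike[OF N eq] show
    "(LINT x:canonical_simplex|lebesgue. g x) = (LINT x:canonical_simplex|lebesgue. f x)"
    by (simp add: set_lebesgue_integral_eq_integral)
qed

lemma integral_canonical_simplex_gen_eval:
  fixes M :: "(real ^ 'n) set"
  assumes "finite M" "\<And>a i. a \<in> M \<Longrightarrow> a $ i > -1"
  shows "set_integrable lebesgue canonical_simplex (gen_eval M c)"
    and "(LINT x:canonical_simplex|lebesgue. gen_eval M c x) =
         (\<Sum>a\<in>M. gen_bombieri c a / Gamma (1 + real CARD('n) + (\<Sum>i\<in>UNIV. a $ i)))"
proof -
  have int: "set_integrable lebesgue canonical_simplex (\<lambda>x. c a * (\<Prod>i\<in>UNIV. (x $ i) powr (a $ i)))"
    if "a \<in> M" for a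
    using integral_canonical_simplex_monomial(1)[of a] assms(2)[OF that] by simp
  have "integral\<^sup>L lebesgue (\<lambda>x. indicator canonical_simplex x *\<^sub>R gen_eval M c x) =
        (\<Sum>a\<in>M. LINT x:canonical_simplex|lebesgue. c a * (\<Prod>i\<in>UNIV. (x $ i) powr (a $ i)))"
    using int unfolding gen_eval_def scaleR_sum_right set_integrable_def set_lebesgue_integral_def
    by (rule Bochner_Integration.integral_sum)
  then show "(LINT x:canonical_simplex|lebesgue. gen_eval M c x) =
         (\<Sum>a\<in>M. gen_bombieri c a / Gamma (1 + real CARD('n) + (\<Sum>i\<in>UNIV. a $ i)))"
    using assms(2) unfolding set_lebesgue_integral_def[of lebesgue canonical_simplex "gen_eval M c"]
    by (simp add: integral_canonical_simplex_monomial(2) gen_bombieri_def mult.commute)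
  show "set_integrable lebesgue canonical_simplex (gen_eval M c)"
    using int unfolding gen_eval_def scaleR_sum_right set_integrable_def
    by (rule Bochner_Integration.integrable_sum)
qed

section \<open>Polynomials, their homogeneous parts and the nodes\<close>

lemma lookup_hom_part:
  "Poly_Mapping.lookup (hom_part j f) \<alpha> = (if monom_degree \<alpha> = j then Poly_Mapping.lookup f \<alpha> else 0)"
  unfolding hom_part_def lookup_sum lookup_single when_def
  by (subst sum.delta) (auto simp: in_keys_iff)

lemma lookup_bombieri:
  "Poly_Mapping.lookup (bombieri f) \<alpha> =
     (\<Prod>i\<in>UNIV. fact (Poly_Mapping.lookup \<alpha> i)) * Poly_Mapping.lookup f \<alpha>"
  unfolding bombieri_def lookup_sum lookup_single when_def
  by (subst sum.delta) (auto simp: in_keys_iff)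

lemma poly_eval_superset:
  assumes "finite S" "Poly_Mapping.keys f \<subseteq> S"
  shows "poly_eval f x = (\<Sum>\<alpha>\<in>S. Poly_Mapping.lookup f \<alpha> * (\<Prod>i\<in>UNIV. (x $ i) ^ Poly_Mapping.lookup \<alpha> i))"
  unfolding poly_eval_def using assms by (intro sum.mono_neutral_left) (auto simp: in_keys_iff)

lemma monom_degree_eq_0_iff: "monom_degree \<alpha> = 0 \<longleftrightarrow> \<alpha> = 0"
  by (auto simp: monom_degree_def intro!: poly_mapping_eqI)

text \<open>Natural exponents are read as real ones, and Gamma at integers gives the factorials. As
  \<open>x ^ 0\<close> and \<open>x powr 0\<close> differ at 0, the two evaluations are compared on
  the open orthant only.\<close>

lemma integral_canonical_simplex_poly_eval:
  fixes f :: "('n::finite \<Rightarrow>\<^sub>0 nat) \<Rightarrow>\<^sub>0 real"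
  shows "set_integrable lebesgue canonical_simplex (poly_eval f)"
    and "(LINT x:canonical_simplex|lebesgue. poly_eval f x) =
         (\<Sum>\<alpha>\<in>Poly_Mapping.keys f. Poly_Mapping.lookup (bombieri f) \<alpha> / fact (CARD('n) + monom_degree \<alpha>))"
proof -
  define v :: "('n \<Rightarrow>\<^sub>0 nat) \<Rightarrow> real ^ 'n" where "v \<alpha> = (\<chi> i. real (Poly_Mapping.lookup \<alpha> i))" for \<alpha>
  have inj: "inj v" by (auto simp: inj_def v_def vec_eq_iff intro!: poly_mapping_eqI)
  \<comment> \<open>Injectivity of \<open>v\<close> lets \<open>inv v\<close> recover the natural
    exponent, hence its coefficient.\<close>
  define c where "c a = Poly_Mapping.lookup f (inv v a)" for a
  have c: "c (v \<alpha>) = Poly_Mapping.lookup f \<alpha>" for \<alpha> using inj by (simp add: c_def)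
  let ?M = "v ` Poly_Mapping.keys f"
  have M: "a $ i > -1" if "a \<in> ?M" for a i using that by (auto simp: v_def intro: less_le_trans[of _ 0])
  have eq: "poly_eval f x = gen_eval ?M c x" if "\<And>i. x $ i > 0" for x
    using inj_on_subset[OF inj] that
    by (simp add: gen_eval_def poly_eval_def sum.reindex c) (simp add: v_def powr_realpow)
  note gen = integral_canonical_simplex_gen_eval[of ?M c, OF finite_imageI[OF finite_keys] M]
  have Gamma: "Gamma (1 + real CARD('n) + (\<Sum>i\<in>UNIV. v \<alpha> $ i)) = fact (CARD('n) + monom_degree \<alpha>)" for \<alpha>
    using Gamma_fact[of "CARD('n) + monom_degree \<alpha>", where 'a = real]
    by (simp add: v_def monom_degree_def add.assoc)
  show "set_integrable lebesgue canonical_simplex (poly_eval f)"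
    using canonical_simplex_integral_spike(1)[OF gen(1) eq] .
  have "(LINT x:canonical_simplex|lebesgue. poly_eval f x) =
        (\<Sum>a\<in>?M. gen_bombieri c a / Gamma (1 + real CARD('n) + (\<Sum>i\<in>UNIV. a $ i)))"
    using canonical_simplex_integral_spike(2)[OF gen(1) eq] gen(2) by simp
  also have "\<dots> = (\<Sum>\<alpha>\<in>Poly_Mapping.keys f. gen_bombieri c (v \<alpha>) / Gamma (1 + real CARD('n) + (\<Sum>i\<in>UNIV. v \<alpha> $ i)))"
    using inj_on_subset[OF inj] by (simp add: sum.reindex)
  also have "\<dots> = (\<Sum>\<alpha>\<in>Poly_Mapping.keys f. Poly_Mapping.lookup (bombieri f) \<alpha> / fact (CARD('n) + monom_degree \<alpha>))"
    unfolding Gamma by (simp add: gen_bombieri_def c lookup_bombieri) (simp add: v_def Gamma_fact)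
  finally show "(LINT x:canonical_simplex|lebesgue. poly_eval f x) =
        (\<Sum>\<alpha>\<in>Poly_Mapping.keys f. Poly_Mapping.lookup (bombieri f) \<alpha> / fact (CARD('n) + monom_degree \<alpha>))" .
qed

lemma fact_add_eq_prod: "fact (n + j) = fact n * (\<Prod>k = 1..j. real (n + k))"
  by (induction j) (simp_all add: algebra_simps)

text \<open>With P = (n+1)...(n+j), every monomial of degree j takes the value 1/P = n!/(n+j)! at
  the node, which is Dirichlet's denominator up to the factor n!.\<close>

lemma poly_eval_bombieri_hom_part_xi_node:
  fixes f :: "('n::finite \<Rightarrow>\<^sub>0 nat) \<Rightarrow>\<^sub>0 real"
  assumes "j \<ge> 1"
  shows "poly_eval (bombieri (hom_part j f)) (xi_node j) =
         fact CARD('n) * (\<Sum>\<alpha> | \<alpha> \<in> Poly_Mapping.keys f \<and> monom_degree \<alpha> = j.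
            Poly_Mapping.lookup (bombieri f) \<alpha> / fact (CARD('n) + monom_degree \<alpha>))"
proof -
  let ?S = "{\<alpha> \<in> Poly_Mapping.keys f. monom_degree \<alpha> = j}"
  define P where "P = (\<Prod>k = 1..j. real (CARD('n) + k))"
  have "P > 0" unfolding P_def by (intro prod_pos) auto
  then have root: "(P powr (1 / real j)) ^ j = P"
    using assms by (subst powr_power) auto
  have fact: "fact (CARD('n) + j) = fact CARD('n) * P" unfolding P_def by (rule fact_add_eq_prod)
  have "poly_eval (bombieri (hom_part j f)) (xi_node j) =
        (\<Sum>\<alpha>\<in>?S. Poly_Mapping.lookup (bombieri (hom_part j f)) \<alpha> *
           (\<Prod>i\<in>UNIV. ((xi_node j :: real ^ 'n) $ i) ^ Poly_Mapping.lookup \<alpha> i))"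
    by (rule poly_eval_superset) (auto simp: in_keys_iff lookup_bombieri lookup_hom_part split: if_splits)
  also have "\<dots> = (\<Sum>\<alpha>\<in>?S. fact CARD('n) * (Poly_Mapping.lookup (bombieri f) \<alpha> / fact (CARD('n) + monom_degree \<alpha>)))"
  proof (intro sum.cong refl)
    fix \<alpha> assume \<alpha>: "\<alpha> \<in> ?S"
    have "(\<Prod>i\<in>UNIV. ((xi_node j :: real ^ 'n) $ i) ^ Poly_Mapping.lookup \<alpha> i) = (1 / P powr (1 / real j)) ^ monom_degree \<alpha>"
      by (simp add: xi_node_def P_def monom_degree_def flip: power_sum)
    also have "\<dots> = 1 / P" using \<alpha> root by (simp add: power_divide)
    finally show "Poly_Mapping.lookup (bombieri (hom_part j f)) \<alpha> *
           (\<Prod>i\<in>UNIV. ((xi_node j :: real ^ 'n) $ i) ^ Poly_Mapping.lookup \<alpha> i) =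
        fact CARD('n) * (Poly_Mapping.lookup (bombieri f) \<alpha> / fact (CARD('n) + monom_degree \<alpha>))"
      using \<alpha> by (simp add: lookup_bombieri lookup_hom_part fact)
  qed
  finally show ?thesis by (simp add: sum_distrib_left)
qed

text \<open>Dirichlet's denominators depend on the degree only, so grouping the monomials by degree
  leaves one homogeneous part per node.\<close>

lemma integral_canonical_simplex_poly_eval_xi_node:
  fixes f :: "('n::finite \<Rightarrow>\<^sub>0 nat) \<Rightarrow>\<^sub>0 real"
  shows "(LINT x:canonical_simplex|lebesgue. poly_eval f x) =
     1 / fact CARD('n) * (Poly_Mapping.lookup (bombieri (hom_part 0 f)) 0 +
       (\<Sum>j = 1..total_degree f. poly_eval (bombieri (hom_part j f)) (xi_node j)))"
proof -
  let ?h = "\<lambda>\<alpha>. Poly_Mapping.lookup (bombieri f) \<alpha> / fact (CARD('n) + monom_degree \<alpha>)"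
  let ?T = "\<lambda>j. \<Sum>\<alpha> | \<alpha> \<in> Poly_Mapping.keys f \<and> monom_degree \<alpha> = j. ?h \<alpha>"
  \<comment> \<open>Only the zero exponent has degree 0. If it is not a key, its coefficient is 0,
    so both cases give the constant term.\<close>
  have "{\<alpha> \<in> Poly_Mapping.keys f. monom_degree \<alpha> = 0} = (if 0 \<in> Poly_Mapping.keys f then {0} else {})"
    by (auto simp: monom_degree_eq_0_iff)
  then have T0: "Poly_Mapping.lookup (bombieri (hom_part 0 f)) 0 = fact CARD('n) * ?T 0"
    by (simp add: lookup_bombieri lookup_hom_part monom_degree_eq_0_iff[THEN iffD2]
             in_keys_iff[of 0 f] del: lookup_not_eq_zero_eq_in_keys)
  have "(LINT x:canonical_simplex|lebesgue. poly_eval f x) = (\<Sum>\<alpha>\<in>Poly_Mapping.keys f. ?h \<alpha>)"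
    by (rule integral_canonical_simplex_poly_eval)
  also have "\<dots> = (\<Sum>j\<in>{..total_degree f}. ?T j)"
    by (rule sum.group[symmetric]) (auto simp: total_degree_def intro!: Max_ge)
  also have "\<dots> = ?T 0 + (\<Sum>j = 1..total_degree f. ?T j)"
    by (subst sum.remove[of _ 0]) (auto simp: atLeast1_atMost_eq_remove0)
  also have "(\<Sum>j = 1..total_degree f. ?T j) =
      (\<Sum>j = 1..total_degree f. poly_eval (bombieri (hom_part j f)) (xi_node j)) / fact CARD('n)"
    by (simp add: poly_eval_bombieri_hom_part_xi_node sum_divide_distrib)
  finally show ?thesis using T0 by (simp add: field_simps)
qed

section \<open>Homogeneous generalized polynomials and the choice of \<theta>\<close>

lemma gen_eval_homogeneous_diagonal:
  assumes "\<theta> > 0" "\<And>a. a \<in> M \<Longrightarrow> (\<Sum>i\<in>UNIV. a $ i) = t"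
  shows "gen_eval M c ((1 / \<theta>) *\<^sub>R vec 1) = (\<Sum>a\<in>M. c a) / \<theta> powr t"
proof -
  have "(\<Prod>i\<in>UNIV. (((1 / \<theta>) *\<^sub>R vec 1 :: real ^ 'a) $ i) powr (a $ i)) = 1 / \<theta> powr t" if "a \<in> M" for a
    using assms(1) assms(2)[OF that] by (simp add: powr_divide prod_dividef flip: powr_sum)
  then show ?thesis by (simp add: gen_eval_def sum_divide_distrib)
qed

text \<open>The diagonal point has coordinate sum n/\<theta>, so it lies in the simplex once
  \<theta> \<ge> n. Below t = -1 this can fail: n = 3 and t = -2 give \<theta> = sqrt 6 < 3. The
  assumption on \<open>t\<close> keeps the Gamma argument above 1.\<close>

lemma exists_theta_in_canonical_simplex:
  fixes t :: real
  assumes "t > - real CARD('n)"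
  shows "\<exists>\<theta>>0. \<theta> powr t = Gamma (1 + real CARD('n) + t) / Gamma (1 + real CARD('n)) \<and>
           (t \<ge> -1 \<longrightarrow> (1 / \<theta>) *\<^sub>R vec 1 \<in> (canonical_simplex :: (real ^ 'n) set))"
proof -
  let ?n = "real CARD('n)"
  define r where "r = Gamma (1 + ?n + t) / Gamma (1 + ?n)"
  have pos: "Gamma (1 + ?n) > 0" "Gamma (1 + ?n + t) > 0" using assms by (auto intro!: Gamma_real_pos)
  then have r: "r > 0" by (simp add: r_def)
  have simplex: "(1 / \<theta>) *\<^sub>R vec 1 \<in> (canonical_simplex :: (real ^ 'n) set)" if "\<theta> \<ge> ?n" "\<theta> > 0" for \<theta>
    using that by (auto simp: canonical_simplex_def inner_vec_def field_simps)
  show ?thesis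
  proof (cases "t = 0")
    case True
    then have "Gamma (1 + ?n + t) / Gamma (1 + ?n) = 1"
      using pos(1)[THEN less_imp_neq] by simp
    \<comment> \<open>For t = 0 every positive \<theta> solves the equation; n is the least one
      whose point lies in the simplex.\<close>
    with True simplex[of ?n] show ?thesis by (intro exI[of _ ?n]) simp
  next
    case False
    define \<theta> where "\<theta> = r powr (1 / t)"
    have \<theta>: "\<theta> > 0" "\<theta> powr t = r" using r False by (auto simp: \<theta>_def powr_powr)
    \<comment> \<open>If \<theta> < n, strict monotonicity of the power in its base, increasing for
      t > 0 and decreasing for t < 0, contradicts the matching Gamma bound.\<close>
    have "\<theta> \<ge> ?n" if "t \<ge> -1"
    proof (rule ccontr)
      assume less: "\<not> \<theta> \<ge> ?n"
      show False
      proof (cases "t > 0")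
        case True
        then have "\<theta> powr t < ?n powr t" using less \<theta> by (intro powr_less_mono2) auto
        moreover have "?n powr t \<le> r"
          using Gamma_plus_real_bounds(1)[of ?n t] True pos by (simp add: r_def field_simps)
        ultimately show False using \<theta> by simp
      next
        case False
        then have "?n powr t < \<theta> powr t" using less \<theta> \<open>t \<noteq> 0\<close> by (intro powr_less_mono2_neg) auto
        moreover have "r \<le> ?n powr t"
          using Gamma_plus_real_bounds(2)[of ?n t] False pos that by (simp add: r_def field_simps)
        ultimately show False using \<theta> by simp
      qed
    qed
    with \<theta> simplex show ?thesis unfolding r_def by blast
  qed
qed

text \<open>The second integral formula covers every admissible \<theta>, which is not unique for t
  = 0; existence is a separate clause. That clause assumes \<open>M \<noteq> {}\<close>, since for
  empty \<open>M\<close> homogeneity leaves \<open>t\<close> arbitrary and the Gamma quotient need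
  not be positive.\<close>

theorem theorem1p1:
  shows
    "(\<forall>(f :: ('n::finite \<Rightarrow>\<^sub>0 nat) \<Rightarrow>\<^sub>0 real) (t :: nat).
        total_degree f = t \<longrightarrow>
        set_integrable lebesgue canonical_simplex (poly_eval f) \<and>
        (LINT x:canonical_simplex|lebesgue. poly_eval f x) =
          1 / fact CARD('n) *
          (Poly_Mapping.lookup (bombieri (hom_part 0 f)) 0 +
           (\<Sum>j = 1..t. poly_eval (bombieri (hom_part j f)) (xi_node j))))
     \<and>
     (\<forall>(M :: (real ^ 'n) set) (c :: real ^ 'n \<Rightarrow> real) (f :: real ^ 'n \<Rightarrow> real) (t :: real).
        finite M \<longrightarrow>
        (\<forall>\<alpha>\<in>M. \<forall>i. \<alpha> $ i > -1) \<longrightarrow>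
        (\<forall>x. (\<forall>i. x $ i > 0) \<longrightarrow> f x = gen_eval M c x) \<longrightarrow>
        (\<forall>\<alpha>\<in>M. (\<Sum>i\<in>UNIV. \<alpha> $ i) = t) \<longrightarrow>
        set_integrable lebesgue canonical_simplex f \<and>
        (\<forall>\<theta>>0. \<theta> powr t = Gamma (1 + real CARD('n) + t) / Gamma (1 + real CARD('n)) \<longrightarrow>
           (LINT x:canonical_simplex|lebesgue. f x) =
             1 / fact CARD('n) * gen_eval M (gen_bombieri c) ((1 / \<theta>) *\<^sub>R vec 1)) \<and>
        (M \<noteq> {} \<longrightarrow>
           (\<exists>\<theta>>0. \<theta> powr t = Gamma (1 + real CARD('n) + t) / Gamma (1 + real CARD('n)) \<and>
              (t \<ge> -1 \<longrightarrow> (1 / \<theta>) *\<^sub>R vec 1 \<in> (canonical_simplex :: (real ^ 'n) set)))))"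
proof (intro conjI allI impI, goal_cases)
  case (1 f t)
  show ?case by (rule integral_canonical_simplex_poly_eval)
next
  case (2 f t)
  then show ?case using integral_canonical_simplex_poly_eval_xi_node[of f] by simp
next
  case (3 M c f t)
  then show ?case
    by (intro canonical_simplex_integral_spike(1)[OF integral_canonical_simplex_gen_eval(1)[of M c]]) auto
next
  case (4 M c f t \<theta>)
  have pos: "Gamma (1 + real CARD('n)) = fact CARD('n)"
    by (rule Gamma_fact)
  have "(LINT x:canonical_simplex|lebesgue. f x) = (LINT x:canonical_simplex|lebesgue. gen_eval M c x)"
    using 4 by (intro canonical_simplex_integral_spike(2)[OF integral_canonical_simplex_gen_eval(1)]) auto
  also have "\<dots> = (\<Sum>a\<in>M. gen_bombieri c a / Gamma (1 + real CARD('n) + (\<Sum>i\<in>UNIV. a $ i)))"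
    using 4 by (intro integral_canonical_simplex_gen_eval(2)) auto
  also have "\<dots> = (\<Sum>a\<in>M. gen_bombieri c a) / Gamma (1 + real CARD('n) + t)"
    using 4 by (simp add: sum_divide_distrib)
  \<comment> \<open>The equation for \<theta> reads Gamma(1+n+t) = n! * \<theta>^t, as Gamma(1+n) =
    n!.\<close>
  also have "\<dots> = 1 / fact CARD('n) * ((\<Sum>a\<in>M. gen_bombieri c a) / \<theta> powr t)"
    using 4 pos by simp
  also have "(\<Sum>a\<in>M. gen_bombieri c a) / \<theta> powr t = gen_eval M (gen_bombieri c) ((1 / \<theta>) *\<^sub>R vec 1)"
    using 4 by (intro gen_eval_homogeneous_diagonal[symmetric]) auto
  finally show ?case .
next
  case (5 M c f t)
  then obtain a where a: "a \<in> M" by blast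
  \<comment> \<open>Every exponent exceeds -1, so a single element of \<open>M\<close> already
    forces t > -n.\<close>
  have "0 < (\<Sum>i\<in>UNIV. a $ i + 1)" using 5 a by (intro sum_pos) (auto simp: less_eq_real_def minus_less_iff, smt (verit))
  with 5 a have "t > - real CARD('n)" by (simp add: sum.distrib)
  then show ?case by (rule exists_theta_in_canonical_simplex)
qed

end
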